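(* Let $n$ be a positive integer, let $(\lambda_1,\ldots,\lambda_n)\in(0,+\infty)^n$, let $\varphi:[0,+\infty)\to(0,+\infty)$ be a nonincreasing function, and let $$t_0:=\frac{\pi}{2}\sum_{k=1}^n\frac{1}{\lambda_k}.$$ Then there exists a function $\delta:[0,+\infty)\to[0,+\infty)$ such that every solution $(u_1(t),\ldots,u_n(t))$ (with each $u_k:[0,+\infty)\to\mathbb{R}$) to the system $$u_k''(t)+2\delta(t)u_k'(t)+\lambda_k^2u_k(t)=0,\qquad k=1,\ldots,n,$$ satisfies $$\sum_{k=1}^n\left(|u_k'(t)|^2+\lambda_k^2|u_k(t)|^2\right)\le\left[\sum_{k=1}^n\left(|u_k'(0)|^2+\lambda_k^2|u_k(0)|^2\right)\right]\cdot\varphi(t)\qquad\forall t\ge t_0.$$ Moreover, $\delta$ can be chosen of class $C^\infty$, and it can alternatively be chosen piecewise constant (i.e. there exist both a $C^\infty$ function $\delta:[0,+\infty)\to[0,+\infty)$ and a piecewise constant function $\delta:[0,+\infty)\to[0,+\infty)$, each of which is such that every solution $(u_1,\ldots,u_n)$ to the system $u_k''(t)+2\delta(t)u_k'(t)+\lambda_k^2u_k(t)=0$, $k=1,\ldots,n$, satisfies $\sum_{k=1}^n\left(|u_k'(t)|^2+\lambda_k^2|u_k(t)|^2\right)\le\left[\sum_{k=1}^n\left(|u_k'(0)|^2+\lambda_k^2|u_k(0)|^2\right)\right]\cdot\varphi(t)$ for every $t\ge t_0$).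
   Context: Piecewise constant means having finitely many constancy intervals on each bounded interval. When $\delta$ is not continuous, a solution is a tuple of functions $u_k\in C^1([0,+\infty))$ with $u_k'$ locally absolutely continuous that satisfies the equations for almost every $t$. *)

theory Defs
  imports "HOL-Analysis.Analysis"
begin

text \<open>
  Functions on \<open>[0, +\<infinity>)\<close> are rendered as total functions \<open>real \<Rightarrow> real\<close> of which only the values
  on \<open>{0..}\<close> matter; accordingly all derivatives are taken within \<open>{0..}\<close>, which makes them
  one-sided at \<open>0\<close>.
\<close>

definition deriv0 :: "(real \<Rightarrow> real) \<Rightarrow> real \<Rightarrow> real" where
  "deriv0 f t = vector_derivative f (at t within {0..})"

definition smooth0 :: "(real \<Rightarrow> real) \<Rightarrow> bool" where
  "smooth0 f \<longleftrightarrow> (\<forall>m. (deriv0 ^^ m) f differentiable_on {0..})"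

text \<open>
  The intervals are required to be non-degenerate, so an isolated value at a single point does not
  count as a constancy interval.
\<close>

definition piecewise_constant0 :: "(real \<Rightarrow> real) \<Rightarrow> bool" where
  "piecewise_constant0 f \<longleftrightarrow>
     (\<forall>T. \<exists>\<I>. finite \<I> \<and> {0..T} \<subseteq> \<Union>\<I> \<and>
        (\<forall>I\<in>\<I>. is_interval I \<and> interior I \<noteq> {} \<and> I \<subseteq> {0..} \<and> f constant_on I))"

text \<open>
  The usual \<open>\<epsilon>\<close>-\<open>\<eta>\<close> definition: \<open>D\<close> ranges over the finite families of non-overlapping compact
  subintervals of \<open>[a, b]\<close>.
\<close>

definition absolutely_cont_on_interval :: "real \<Rightarrow> real \<Rightarrow> (real \<Rightarrow> real) \<Rightarrow> bool" where
  "absolutely_cont_on_interval a b f \<longleftrightarrow>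
     (\<forall>\<epsilon>>0. \<exists>\<eta>>0. \<forall>D. D division_of \<Union>D \<and> \<Union>D \<subseteq> {a..b} \<and> (\<Sum>K\<in>D. Sup K - Inf K) < \<eta> \<longrightarrow>
        (\<Sum>K\<in>D. \<bar>f (Sup K) - f (Inf K)\<bar>) < \<epsilon>)"

definition locally_absolutely_cont0 :: "(real \<Rightarrow> real) \<Rightarrow> bool" where
  "locally_absolutely_cont0 f \<longleftrightarrow> (\<forall>T>0. absolutely_cont_on_interval 0 T f)"

definition damped_eq :: "real \<Rightarrow> (real \<Rightarrow> real) \<Rightarrow> (real \<Rightarrow> real) \<Rightarrow> real \<Rightarrow> bool" where
  "damped_eq l \<delta> v t \<longleftrightarrow> deriv0 (deriv0 v) t + 2 * \<delta> t * deriv0 v t + l\<^sup>2 * v t = 0"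

text \<open>For continuous \<open>\<delta>\<close> the equation forces \<open>v''\<close> to be continuous, so \<open>C\<^sup>2\<close> need not be required.\<close>

definition classical_solution :: "real \<Rightarrow> (real \<Rightarrow> real) \<Rightarrow> (real \<Rightarrow> real) \<Rightarrow> bool" where
  "classical_solution l \<delta> v \<longleftrightarrow>
     v differentiable_on {0..} \<and> deriv0 v differentiable_on {0..} \<and>
     (\<forall>t\<ge>0. damped_eq l \<delta> v t)"

definition caratheodory_solution :: "real \<Rightarrow> (real \<Rightarrow> real) \<Rightarrow> (real \<Rightarrow> real) \<Rightarrow> bool" where
  "caratheodory_solution l \<delta> v \<longleftrightarrow>
     v differentiable_on {0..} \<and> continuous_on {0..} (deriv0 v) \<and>
     locally_absolutely_cont0 (deriv0 v) \<and>
     (AE t in lebesgue. t \<ge> 0 \<longrightarrow>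
        deriv0 v differentiable (at t within {0..}) \<and> damped_eq l \<delta> v t)"

definition system_solution ::
    "nat \<Rightarrow> (nat \<Rightarrow> real) \<Rightarrow> (real \<Rightarrow> real) \<Rightarrow> (nat \<Rightarrow> real \<Rightarrow> real) \<Rightarrow> bool" where
  "system_solution n lam \<delta> u \<longleftrightarrow>
     (\<forall>k\<in>{1..n}. if continuous_on {0..} \<delta> then classical_solution (lam k) \<delta> (u k)
                 else caratheodory_solution (lam k) \<delta> (u k))"

definition energy :: "nat \<Rightarrow> (nat \<Rightarrow> real) \<Rightarrow> (nat \<Rightarrow> real \<Rightarrow> real) \<Rightarrow> real \<Rightarrow> real" where
  "energy n lam u t = (\<Sum>k=1..n. \<bar>deriv0 (u k) t\<bar>\<^sup>2 + (lam k)\<^sup>2 * \<bar>u k t\<bar>\<^sup>2)"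

end

theory Submission
  imports Defs
begin

text \<open>
  A short and very strong burst of damping almost annihilates every velocity \<open>u\<^sub>k'\<close>: the dissipated
  energy is \<open>\<integral> 4 \<delta> |u\<^sub>k'|\<^sup>2\<close>, so a large burst forces \<open>u\<^sub>k'\<close> to be small at some instant. If the system
  then moves freely for a time \<open>\<pi> / (2 \<lambda>\<^sub>k)\<close>, the \<open>k\<close>-th component has turned its displacement into
  velocity, and a second burst removes almost all of its energy. Since all energies are nonincreasing,
  treating the \<open>n\<close> components one after the other takes time \<open>t\<^sub>0\<close> and multiplies the total energy by a
  factor as small as we like; the loss of time caused by the width of the bursts only affects that
  factor. Repeating this on \<open>[j t\<^sub>0, (j + 1) t\<^sub>0]\<close> with the factor \<open>\<phi> ((j + 2) t\<^sub>0)\<close> gives the decay,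
  because \<open>\<phi>\<close> is nonincreasing. Bursts of smooth and of rectangular shape are equally good.
\<close>

hide_const (open) Polynomial.content

section \<open>Absolutely continuous functions\<close>

text \<open>Outer regularity of Lebesgue measure. The set \<open>U\<close> will serve as the gauge
  at tags in the exceptional set, with \<open>\<eta>\<close> taken from absolute continuity.\<close>

lemma negligible_imp_open_cover:
  assumes "negligible N" and "\<eta> > (0::real)"
  obtains U where "open U" "N \<subseteq> U" "U \<in> lmeasurable" "measure lebesgue U < \<eta>"
proof -
  have null: "N \<in> null_sets lebesgue"
    using assms negligible_iff_null_sets by blast
  then obtain U where U: "open U" "N \<subseteq> U" "U - N \<in> lmeasurable"
      "emeasure lebesgue (U - N) < ennreal \<eta>"
    using sets_lebesgue_outer_open[of N \<eta>] assms by (metis null_setsD2)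
  have Ueq: "U = (U - N) \<union> N" using U by auto
  have "U \<in> lmeasurable"
    using U(3) assms(1) Ueq by (metis fmeasurable.Un negligible_imp_measurable)
  moreover have "emeasure lebesgue U = emeasure lebesgue (U - N)"
    using null U(1) by (simp add: emeasure_Diff_null_set)
  ultimately show ?thesis
    using that U assms(2) by (simp add: emeasure_eq_measure2 ennreal_less_iff)
qed

text \<open>In Riemann sums the intervals tagged in \<open>N\<close> stay inside an open set of small measure, so absolute
  continuity controls their total increment; elsewhere the increments are governed by the derivative.\<close>

lemma absolutely_cont_has_integral:
  assumes ac: "absolutely_cont_on_interval a b v" and "a \<le> b" and N: "negligible N"
    and der: "\<And>x. x \<in> {a..b} - N \<Longrightarrow> (v has_real_derivative f x) (at x within {a..b})"
  shows "(f has_integral v b - v a) {a..b}"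
proof -
  \<comment> \<open>Resetting the integrand to 0 on the null set \<open>N\<close> leaves the
    integral unchanged, and an interval tagged in \<open>N\<close> then contributes nothing but its
    increment of \<open>v\<close>.\<close>
  define g where "g x = (if x \<in> N then 0 else f x)" for x
  have "(g has_integral v b - v a) (cbox a b)"
    unfolding has_integral
  proof (intro allI impI)
    fix e :: real assume "e > 0"
    \<comment> \<open>The slope error allowed off \<open>N\<close>: it sums to
      \<open>e1 * (b - a)\<close>, which is below \<open>e / 2\<close>. The summand 1 keeps the
      denominator positive when \<open>a = b\<close>.\<close>
    define e1 where "e1 = e / (2 * (b - a + 1))"
    have e1: "e1 > 0" using \<open>e > 0\<close> \<open>a \<le> b\<close> by (simp add: e1_def)
    obtain \<eta> where \<eta>: "\<eta> > 0" and ac': "\<And>D. D division_of \<Union>D \<Longrightarrow> \<Union>D \<subseteq> {a..b} \<Longrightarrow>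
        (\<Sum>K\<in>D. Sup K - Inf K) < \<eta> \<Longrightarrow> (\<Sum>K\<in>D. \<bar>v (Sup K) - v (Inf K)\<bar>) < e / 2"
      using ac \<open>e > 0\<close> unfolding absolutely_cont_on_interval_def by (meson half_gt_zero)
    obtain U where U: "open U" "N \<subseteq> U" "U \<in> lmeasurable" "measure lebesgue U < \<eta>"
      using negligible_imp_open_cover[OF N \<eta>] .
    have "\<forall>x. \<exists>d>0. x \<in> {a..b} - N \<longrightarrow>
        (\<forall>y\<in>{a..b}. \<bar>y - x\<bar> < d \<longrightarrow> \<bar>v y - v x - f x * (y - x)\<bar> \<le> e1 * \<bar>y - x\<bar>)"
    proof
      fix x
      show "\<exists>d>0. x \<in> {a..b} - N \<longrightarrow>
        (\<forall>y\<in>{a..b}. \<bar>y - x\<bar> < d \<longrightarrow> \<bar>v y - v x - f x * (y - x)\<bar> \<le> e1 * \<bar>y - x\<bar>)"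
      proof (cases "x \<in> {a..b} - N")
        case True
        then show ?thesis
          using der[OF True] e1
          unfolding has_field_derivative_def has_derivative_within_alt by (auto simp: mult.commute)
      qed (auto intro: zero_less_one)
    qed
    then obtain d where dpos: "\<And>x. d x > 0" and d: "\<And>x y. x \<in> {a..b} - N \<Longrightarrow> y \<in> {a..b} \<Longrightarrow>
        \<bar>y - x\<bar> < d x \<Longrightarrow> \<bar>v y - v x - f x * (y - x)\<bar> \<le> e1 * \<bar>y - x\<bar>"
      by metis
    define \<gamma> where "\<gamma> x = (if x \<in> N then U else ball x (d x))" for x
    have "gauge \<gamma>"
      using U dpos by (auto simp: gauge_def \<gamma>_def)
    moreover have "norm ((\<Sum>(x,K)\<in>p. content K *\<^sub>R g x) - (v b - v a)) < e"
      if p: "p tagged_division_of cbox a b" and fine: "\<gamma> fine p" for p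
    proof -
      note pD = tagged_division_ofD[OF p]
      have K: "\<exists>l r. K = {l..r} \<and> l \<le> x \<and> x \<le> r \<and> a \<le> l \<and> r \<le> b" if "(x, K) \<in> p" for x K
      proof -
        have "x \<in> K" "K \<subseteq> {a..b}" "\<exists>l r. K = {l..r}"
          using pD(2,3,4)[OF that] by auto
        then show ?thesis by fastforce
      qed
      define q where "q = {xK \<in> p. fst xK \<in> N}"
      have fin: "finite p" "finite q" using pD(1) by (auto simp: q_def)
      have qp: "q \<subseteq> p" by (auto simp: q_def)
      let ?D = "\<lambda>K. v (Sup K) - v (Inf K)"
      have q: "q tagged_division_of \<Union>(snd ` q)"
        using p tagged_partial_division_subset[OF _ qp] tagged_partial_division_of_Union_self
        by (auto simp: tagged_division_of_def)
      define D where "D = snd ` q"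
      have D: "D division_of \<Union>D"
        using division_of_tagged_division[OF q] by (simp add: D_def)
      have DK: "\<exists>x. (x, K) \<in> p \<and> x \<in> N" if "K \<in> D" for K
        using that by (auto simp: D_def q_def)
      have Dsub: "\<Union>D \<subseteq> {a..b}"
        using DK pD(3) by fastforce
      have DU: "\<Union>D \<subseteq> U"
        using DK fine unfolding fine_def \<gamma>_def by fastforce
      have "(\<Sum>K\<in>D. Sup K - Inf K) = (\<Sum>K\<in>D. measure lebesgue K)"
      proof (rule sum.cong)
        fix k assume "k \<in> D"
        then obtain x where "(x, k) \<in> p" using DK by blast
        then show "Sup k - Inf k = measure lebesgue k"
          using K by fastforce
      qed simp
      also have "\<dots> = measure lebesgue (\<Union>D)"
        using content_division[OF D] .
      also have "\<dots> \<le> measure lebesgue U"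
        using DU U(3) D by (intro measure_mono_fmeasurable) (auto simp: fmeasurableD lmeasurable_division)
      finally have "(\<Sum>K\<in>D. \<bar>?D K\<bar>) < e / 2"
        using ac'[OF D Dsub] U(4) by linarith
      \<comment> \<open>Distinct tags may share an interval, so the two sums agree only because such
        an interval has empty interior, hence zero increment. The variant \<open>?D'\<close> also
        vanishes on the empty box, as the summation lemma demands.\<close>
      moreover have "(\<Sum>(x,K)\<in>q. \<bar>?D K\<bar>) = (\<Sum>K\<in>D. \<bar>?D K\<bar>)"
      proof -
        let ?D' = "\<lambda>K. if K = {} then 0 else \<bar>?D K\<bar>"
        have ne: "K \<noteq> {}" if "(x, K) \<in> p" for x K using pD(2)[OF that] by auto
        have "(\<Sum>(x,K)\<in>q. \<bar>?D K\<bar>) = (\<Sum>(x,K)\<in>q. ?D' K)"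
          using qp ne by (intro sum.cong) fastforce+
        also have "\<dots> = (\<Sum>K\<in>D. ?D' K)"
          unfolding D_def
        proof (rule sum.over_tagged_division_lemma[OF q])
          fix l r :: real assume "box l r = {}"
          then have "l > r \<or> l = r" by (auto simp: box_eq_empty)
          then show "?D' (cbox l r) = 0" by auto
        qed
        also have "\<dots> = (\<Sum>K\<in>D. \<bar>?D K\<bar>)"
          using DK ne by (intro sum.cong) fastforce+
        finally show ?thesis .
      qed
      ultimately have qbound: "(\<Sum>(x,K)\<in>q. \<bar>?D K\<bar>) < e / 2" by simp
      have rest: "(\<Sum>(x,K)\<in>p - q. \<bar>content K * g x - ?D K\<bar>) \<le> (\<Sum>(x,K)\<in>p - q. e1 * content K)"
      proof (rule sum_mono, safe)
        fix x k assume xk: "(x, k) \<in> p" "(x, k) \<notin> q"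
        obtain l r where lr: "k = {l..r}" "l \<le> x" "x \<le> r" "a \<le> l" "r \<le> b"
          using K[OF xk(1)] by blast
        have xN: "x \<in> {a..b} - N" using xk lr by (auto simp: q_def)
        have "k \<subseteq> ball x (d x)"
          using fineD[OF fine xk(1)] xN by (simp add: \<gamma>_def)
        moreover have "l \<in> k" "r \<in> k" using lr by auto
        ultimately have "\<bar>l - x\<bar> < d x" "\<bar>r - x\<bar> < d x"
          by (auto simp: dist_real_def abs_minus_commute)
        then have "\<bar>v l - v x - f x * (l - x)\<bar> \<le> e1 * \<bar>l - x\<bar>" "\<bar>v r - v x - f x * (r - x)\<bar> \<le> e1 * \<bar>r - x\<bar>"
          using lr by (auto intro!: d[OF xN] simp del: abs_of_nonneg abs_of_nonpos)
        \<comment> \<open>Straddle argument: \<open>x\<close> lies between \<open>l\<close> and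
          \<open>r\<close>, so the errors at the two endpoints add up to at most
          \<open>e1 * (r - l)\<close>.\<close>
        then have "\<bar>f x * (r - l) - (v r - v l)\<bar> \<le> e1 * (r - l)"
          using lr(2,3) unfolding abs_le_iff by (simp add: algebra_simps)
        then show "\<bar>content k * g x - ?D k\<bar> \<le> e1 * content k"
          using lr xN by (simp add: g_def mult.commute)
      qed
      also have "\<dots> \<le> (\<Sum>(x,K)\<in>p. e1 * content K)"
        using fin e1 by (intro sum_mono2) auto
      also have "\<dots> = e1 * (b - a)"
        using additive_content_tagged_division[OF p] \<open>a \<le> b\<close>
        by (simp add: sum_distrib_left[symmetric] split_beta)
      also have "\<dots> < e / 2"
        using \<open>a \<le> b\<close> \<open>e > 0\<close> by (simp add: e1_def field_simps)
      finally have pq: "(\<Sum>(x,K)\<in>p - q. \<bar>content K * g x - ?D K\<bar>) < e / 2" .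
      have "(\<Sum>(x,K)\<in>p. content K *\<^sub>R g x) - (v b - v a) = (\<Sum>(x,K)\<in>p. content K * g x - ?D K)"
        using additive_tagged_division_1[OF \<open>a \<le> b\<close>, of p v] p
        by (simp add: sum_subtractf split_beta)
      also have "\<bar>\<dots>\<bar> \<le> (\<Sum>(x,K)\<in>p. \<bar>content K * g x - ?D K\<bar>)"
        by (rule order_trans[OF sum_abs]) (simp add: split_beta)
      also have "\<dots> = (\<Sum>(x,K)\<in>p - q. \<bar>content K * g x - ?D K\<bar>) + (\<Sum>(x,K)\<in>q. \<bar>content K * g x - ?D K\<bar>)"
        by (rule sum.subset_diff[OF qp fin(1)])
      also have "(\<Sum>(x,K)\<in>q. \<bar>content K * g x - ?D K\<bar>) = (\<Sum>(x,K)\<in>q. \<bar>?D K\<bar>)"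
        by (rule sum.cong) (auto simp: q_def g_def)
      finally show ?thesis using pq qbound by simp
    qed
    ultimately show "\<exists>\<gamma>. gauge \<gamma> \<and> (\<forall>p. p tagged_division_of cbox a b \<and> \<gamma> fine p \<longrightarrow>
        norm ((\<Sum>(x,K)\<in>p. content K *\<^sub>R g x) - (v b - v a)) < e)"
      by (intro exI[of _ \<gamma>]) simp
  qed
  then have "(f has_integral v b - v a) (cbox a b)"
    using has_integral_spike[OF N, of "cbox a b" f g] by (simp add: g_def)
  then show ?thesis by simp
qed

section \<open>Energy estimates for one damped oscillator\<close>

text \<open>Both notions of solution collapse to this one: the equation holds off a locally finite set.\<close>

definition damped_trajectory ::
    "real \<Rightarrow> (real \<Rightarrow> real) \<Rightarrow> real set \<Rightarrow> (real \<Rightarrow> real) \<Rightarrow> (real \<Rightarrow> real) \<Rightarrow> bool" where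
  "damped_trajectory l \<delta> S u v \<longleftrightarrow>
     (\<forall>T. finite (S \<inter> {0..T})) \<and> continuous_on {0..} u \<and> continuous_on {0..} v \<and>
     (\<forall>t>0. (u has_real_derivative v t) (at t)) \<and>
     (\<forall>t>0. t \<notin> S \<longrightarrow> (v has_real_derivative - 2 * \<delta> t * v t - l\<^sup>2 * u t) (at t))"

text \<open>A mean value inequality that tolerates finitely many points without derivative, by the
  strong fundamental theorem of calculus. The differential inequalities for trajectories are
  integrated with it.\<close>

lemma diff_le_of_derivative_le:
  fixes f :: "real \<Rightarrow> real"
  assumes "finite S" "a \<le> b" "continuous_on {a..b} f"
    and "\<And>x. x \<in> {a<..<b} - S \<Longrightarrow> (f has_real_derivative f' x) (at x)"
    and "\<And>x. x \<in> {a<..<b} - S \<Longrightarrow> f' x \<le> c"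
  shows "f b - f a \<le> c * (b - a)"
proof -
  \<comment> \<open>The default value \<open>c\<close> makes the bound \<open>g x \<le> c\<close>
    hold at the exceptional points too.\<close>
  define g where "g x = (if x \<in> {a<..<b} - S then f' x else c)" for x
  have "(g has_integral f b - f a) {a..b}"
    using assms
    by (intro fundamental_theorem_of_calculus_interior_strong[of S])
       (auto simp: g_def has_real_derivative_iff_has_vector_derivative)
  moreover have "((\<lambda>_. c) has_integral c * (b - a)) {a..b}"
    using has_integral_const_real[of c a b] \<open>a \<le> b\<close> by (simp add: mult.commute)
  ultimately show ?thesis
    by (rule has_integral_le) (use assms(5) in \<open>auto simp: g_def\<close>)
qed

definition component_energy :: "real \<Rightarrow> (real \<Rightarrow> real) \<Rightarrow> (real \<Rightarrow> real) \<Rightarrow> real \<Rightarrow> real" where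
  "component_energy l u v t = (v t)\<^sup>2 + l\<^sup>2 * (u t)\<^sup>2"

lemma component_energy_nonneg: "component_energy l u v t \<ge> 0"
  by (simp add: component_energy_def)

locale damped_oscillator =
  fixes l :: real and \<delta> :: "real \<Rightarrow> real" and S :: "real set" and u v :: "real \<Rightarrow> real"
  assumes traj: "damped_trajectory l \<delta> S u v"
    and damping_nonneg: "\<And>t. t \<ge> 0 \<Longrightarrow> \<delta> t \<ge> 0"
    and freq_pos: "l > 0"
begin

abbreviation "e \<equiv> component_energy l u v"

lemma trajectory_derivs:
  assumes "0 \<le> a" "x \<in> {a<..<b} - (S \<inter> {0..b})"
  shows "(u has_real_derivative v x) (at x)"
    "(v has_real_derivative - 2 * \<delta> x * v x - l\<^sup>2 * u x) (at x)"
  using traj assms by (auto simp: damped_trajectory_def)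

lemma trajectory_cont:
  assumes "0 \<le> a"
  shows "continuous_on {a..b} u" "continuous_on {a..b} v"
proof -
  have "{a..b} \<subseteq> {0..}" using assms by auto
  then show "continuous_on {a..b} u" "continuous_on {a..b} v"
    using traj by (auto simp: damped_trajectory_def elim: continuous_on_subset)
qed

lemma trajectory_finite: "finite (S \<inter> {0..b})"
  using traj by (auto simp: damped_trajectory_def)

lemma energy_cont: "0 \<le> a \<Longrightarrow> continuous_on {a..b} e"
  unfolding component_energy_def by (intro continuous_intros trajectory_cont)

text \<open>The terms of the conservative part cancel, so that only the work of the damping
  remains.\<close>

lemma energy_deriv:
  assumes "0 \<le> a" "x \<in> {a<..<b} - (S \<inter> {0..b})"
  shows "(e has_real_derivative - 4 * \<delta> x * (v x)\<^sup>2) (at x)"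
  unfolding component_energy_def
  by (rule derivative_eq_intros trajectory_derivs[OF assms] refl)+ (simp add: algebra_simps power2_eq_square)

lemma energy_decreasing:
  assumes "0 \<le> a" "a \<le> b"
  shows "e b \<le> e a"
proof -
  have "e b - e a \<le> 0 * (b - a)"
  proof (rule diff_le_of_derivative_le[OF trajectory_finite assms(2) energy_cont[OF assms(1)] energy_deriv[OF assms(1)]])
    fix x assume "x \<in> {a<..<b} - (S \<inter> {0..b})"
    then show "- 4 * \<delta> x * (v x)\<^sup>2 \<le> 0"
      using damping_nonneg[of x] assms(1) by simp
  qed auto
  then show ?thesis by simp
qed

lemma energy_drop:
  assumes "0 \<le> a" "a \<le> b" "M \<ge> 0" "m \<ge> 0"
    and "\<And>t. t \<in> {a..b} \<Longrightarrow> \<delta> t \<ge> M" "\<And>t. t \<in> {a..b} \<Longrightarrow> (v t)\<^sup>2 \<ge> m"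
  shows "e b \<le> e a - 4 * M * m * (b - a)"
proof -
  have "e b - e a \<le> (- 4 * M * m) * (b - a)"
  proof (rule diff_le_of_derivative_le[OF trajectory_finite assms(2) energy_cont[OF assms(1)] energy_deriv[OF assms(1)]])
    fix x assume "x \<in> {a<..<b} - (S \<inter> {0..b})"
    then have "M * m \<le> \<delta> x * (v x)\<^sup>2"
      using assms by (intro mult_mono) (auto intro: order_trans)
    then show "- 4 * \<delta> x * (v x)\<^sup>2 \<le> - 4 * M * m" by simp
  qed auto
  then show ?thesis by simp
qed

text \<open>Damping can only slow the motion, and the restoring force changes the squared velocity
  at a rate of at most \<open>l\<close> times the energy, by expanding the square of
  \<open>v + l * u\<close>. The bound is uniform in the strength of the damping, so it is available
  inside a pulse.\<close>

lemma velocity_growth: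
  assumes "0 \<le> c" "c \<le> a" "a \<le> b"
  shows "(v b)\<^sup>2 \<le> (v a)\<^sup>2 + l * e c * (b - a)"
proof -
  have a: "0 \<le> a" using assms by simp
  have "(v b)\<^sup>2 - (v a)\<^sup>2 \<le> l * e c * (b - a)"
  proof (rule diff_le_of_derivative_le[OF trajectory_finite assms(3), where f = "\<lambda>t. (v t)\<^sup>2"
        and f' = "\<lambda>x. 2 * v x * (- 2 * \<delta> x * v x - l\<^sup>2 * u x)"])
    show "continuous_on {a..b} (\<lambda>t. (v t)\<^sup>2)"
      by (intro continuous_intros trajectory_cont a)
    fix x assume x: "x \<in> {a<..<b} - (S \<inter> {0..b})"
    show "((\<lambda>t. (v t)\<^sup>2) has_real_derivative 2 * v x * (- 2 * \<delta> x * v x - l\<^sup>2 * u x)) (at x)"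
      by (rule derivative_eq_intros trajectory_derivs[OF a x] refl)+ simp
    have "e x \<le> e c" using x assms by (intro energy_decreasing) auto
    then have "l * e x \<le> l * e c" using freq_pos by simp
    moreover have "0 \<le> l * (v x + l * u x)\<^sup>2" using freq_pos by simp
    then have "- 2 * l\<^sup>2 * u x * v x \<le> l * e x"
      by (simp add: component_energy_def power2_eq_square algebra_simps)
    moreover have "0 \<le> \<delta> x * (v x)\<^sup>2" using damping_nonneg x a by simp
    ultimately show "2 * v x * (- 2 * \<delta> x * v x - l\<^sup>2 * u x) \<le> l * e c"
      by (simp add: power2_eq_square algebra_simps)
  qed
  then show ?thesis by simp
qed

text \<open>A pulse that dissipates all the available energy must slow the motion down at some instant;
  afterwards the velocity has no time to grow back.\<close>

lemma velocity_after_pulse: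
  assumes "0 \<le> a" "a \<le> a'" "a' < b'" "b' \<le> b" "M > 0" "\<And>t. t \<in> {a'..b'} \<Longrightarrow> \<delta> t \<ge> M"
  shows "(v b)\<^sup>2 \<le> (1 / (4 * M * (b' - a')) + l * (b - a)) * e a"
proof -
  \<comment> \<open>The level of squared velocity at which a damping \<open>M\<close> on
    \<open>{a'..b'}\<close> would dissipate exactly the energy \<open>e a\<close>.\<close>
  define m where "m = e a / (4 * M * (b' - a'))"
  have m0: "m \<ge> 0" using component_energy_nonneg assms by (simp add: m_def)
  have meq: "4 * M * m * (b' - a') = e a" using assms by (simp add: m_def)
  have "\<exists>t\<in>{a'..b'}. (v t)\<^sup>2 \<le> m"
  proof (rule ccontr)
    assume "\<not> ?thesis"
    \<comment> \<open>Staying above \<open>m\<close> would exhaust the energy by time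
      \<open>b'\<close>, forcing zero velocity there, although its square exceeds
      \<open>m\<close>.\<close>
    then have big: "\<And>t. t \<in> {a'..b'} \<Longrightarrow> (v t)\<^sup>2 > m" by force
    have "e b' \<le> e a' - 4 * M * m * (b' - a')"
      using assms m0 big by (intro energy_drop) (auto intro: less_imp_le)
    moreover have "e a' \<le> e a" using assms energy_decreasing by simp
    ultimately have "e b' \<le> 0" using meq by linarith
    moreover have "(v b')\<^sup>2 \<le> e b'" by (simp add: component_energy_def)
    ultimately have "(v b')\<^sup>2 \<le> 0" by linarith
    moreover have "m < (v b')\<^sup>2" using big assms(3) by simp
    ultimately show False using m0 by linarith
  qed
  then obtain t where t: "t \<in> {a'..b'}" "(v t)\<^sup>2 \<le> m" by blast
  have "(v b)\<^sup>2 \<le> (v t)\<^sup>2 + l * e a * (b - t)"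
    using t assms by (intro velocity_growth) auto
  also have "\<dots> \<le> m + l * e a * (b - a)"
    using t assms freq_pos component_energy_nonneg by (intro add_mono mult_left_mono) auto
  finally show ?thesis by (simp add: m_def algebra_simps)
qed

text \<open>The speed never exceeds the square root of the energy. This limits the drift of the
  position while the second pulse acts.\<close>

lemma position_displacement:
  assumes "0 \<le> c" "c \<le> a" "a \<le> b"
  shows "\<bar>u b - u a\<bar> \<le> sqrt (e c) * (b - a)"
proof -
  have a: "0 \<le> a" using assms by simp
  have vb: "\<bar>v x\<bar> \<le> sqrt (e c)" if "x \<in> {a<..<b} - (S \<inter> {0..b})" for x
  proof -
    have "(v x)\<^sup>2 \<le> e x" by (simp add: component_energy_def)
    also have "\<dots> \<le> e c" using that assms by (intro energy_decreasing) auto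
    finally show ?thesis by (simp add: real_le_rsqrt)
  qed
  have "u b - u a \<le> sqrt (e c) * (b - a)"
    using vb by (intro diff_le_of_derivative_le[OF trajectory_finite assms(3) trajectory_cont(1)[OF a]
      trajectory_derivs(1)[OF a]]) (auto simp: abs_le_iff)
  moreover have "- u b - (- u a) \<le> sqrt (e c) * (b - a)"
    using vb by (intro diff_le_of_derivative_le[OF trajectory_finite assms(3) 
      continuous_on_minus[OF trajectory_cont(1)[OF a]] DERIV_minus[OF trajectory_derivs(1)[OF a]]]) (auto simp: abs_le_iff)
  ultimately show ?thesis by linarith
qed

lemma free_rotation:
  assumes "0 \<le> a" "a \<le> b" "\<And>t. t \<in> {a<..<b} \<Longrightarrow> \<delta> t = 0"
  shows "l * u b = l * u a * cos (l * (b - a)) + v a * sin (l * (b - a))"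
proof -
  \<comment> \<open>\<open>w t\<close> is \<open>l * u b\<close> as predicted from the state at time \<open>t\<close> under undamped motion.\<close>
  define w where "w t = l * u t * cos (l * (b - t)) + v t * sin (l * (b - t))" for t
  have cont: "continuous_on {a..b} w"
    unfolding w_def by (intro continuous_intros trajectory_cont assms)
  have der: "(w has_real_derivative 0) (at x)" if x: "x \<in> {a<..<b} - (S \<inter> {0..b})" for x
  proof -
    have "\<delta> x = 0" using assms x by auto
    then show ?thesis
      unfolding w_def
      by - ((rule derivative_eq_intros trajectory_derivs[OF assms(1) x] refl)+,
         simp add: algebra_simps power2_eq_square)
  qed
  have "w b - w a \<le> 0 * (b - a)"
    by (rule diff_le_of_derivative_le[OF trajectory_finite assms(2) cont der]) auto
  moreover have "- w b - (- w a) \<le> 0 * (b - a)"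
    by (rule diff_le_of_derivative_le[OF trajectory_finite assms(2) continuous_on_minus[OF cont] DERIV_minus[OF der]]) auto
  ultimately have "w b = w a" by simp
  then show ?thesis by (simp add: w_def)
qed

text \<open>The choice of \<open>M\<close> makes the two contributions in \<open>velocity_after_pulse\<close> equal. After the
  first pulse the state is almost a pure displacement, a quarter of a period turns it into an almost
  pure velocity, and the second pulse removes the velocity.\<close>

lemma quarter_period_contraction:
  assumes "0 \<le> a" and b: "b = a + pi / (2 * l)" and eps: "0 < \<epsilon>" "l * \<epsilon> \<le> 1 / 2"
    and M: "M = 1 / (2 * l * \<epsilon>\<^sup>2)"
    and pulse1: "\<And>t. t \<in> {a + \<epsilon> / 4..a + 3 * \<epsilon> / 4} \<Longrightarrow> \<delta> t \<ge> M"
    and pulse2: "\<And>t. t \<in> {b - 3 * \<epsilon> / 4..b - \<epsilon> / 4} \<Longrightarrow> \<delta> t \<ge> M"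
    and free: "\<And>t. t \<in> {a + \<epsilon><..<b - \<epsilon>} \<Longrightarrow> \<delta> t = 0"
  shows "e b \<le> 24 * (l * \<epsilon>) * e a"
proof -
  define x where "x = l * \<epsilon>"
  have x: "0 < x" "x \<le> 1 / 2" using eps freq_pos by (auto simp: x_def)
  define R where "R = e a"
  have R: "R \<ge> 0" by (simp add: R_def component_energy_nonneg)
  have M0: "M > 0" using M eps freq_pos by simp
  have Mx: "1 / (4 * M * (\<epsilon> / 2)) = x"
    using eps freq_pos by (simp add: M x_def power2_eq_square field_simps)
  have len: "l * (b - a) = pi / 2" using freq_pos by (simp add: b)
  \<comment> \<open>Both pulse windows fit into the quarter period: together they turn through an
    angle of at most 1, which is less than \<open>pi / 2\<close>.\<close>
  have "l * (2 * \<epsilon>) \<le> l * (b - a)"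
    using x pi_gt3 by (simp add: len x_def)
  then have gap: "a + \<epsilon> \<le> b - \<epsilon>" using freq_pos by simp
  \<comment> \<open>One estimate serves both windows, with \<open>c = a\<close> and
    \<open>c = b - \<epsilon>\<close>. Dissipation on the plateau of length
    \<open>\<epsilon> / 2\<close> and regrowth over the window cost \<open>x\<close> each.\<close>
  have small: "(v (c + \<epsilon>))\<^sup>2 \<le> 2 * x * R"
    if c: "a \<le> c" and p: "\<And>t. t \<in> {c + \<epsilon> / 4..c + 3 * \<epsilon> / 4} \<Longrightarrow> \<delta> t \<ge> M" for c
  proof -
    have "(v (c + \<epsilon>))\<^sup>2 \<le> (1 / (4 * M * ((c + 3 * \<epsilon> / 4) - (c + \<epsilon> / 4))) + l * (c + \<epsilon> - c)) * e c"
      using c p M0 eps \<open>0 \<le> a\<close> by (intro velocity_after_pulse) auto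
    also have "(c + 3 * \<epsilon> / 4) - (c + \<epsilon> / 4) = \<epsilon> / 2" by simp
    also have "(1 / (4 * M * (\<epsilon> / 2)) + l * (c + \<epsilon> - c)) = 2 * x"
      unfolding Mx by (simp add: x_def)
    also have "2 * x * e c \<le> 2 * x * R"
      using x energy_decreasing[of a c] c \<open>0 \<le> a\<close> by (simp add: R_def)
    finally show ?thesis .
  qed
  have v1: "(v (a + \<epsilon>))\<^sup>2 \<le> 2 * x * R"
    using small[of a] pulse1 by simp
  have v2: "(v b)\<^sup>2 \<le> 2 * x * R"
  proof -
    have "b - 3 * \<epsilon> / 4 = b - \<epsilon> + \<epsilon> / 4" "b - \<epsilon> / 4 = b - \<epsilon> + 3 * \<epsilon> / 4" by simp_all
    then show ?thesis using small[of "b - \<epsilon>"] pulse2 gap eps by simp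
  qed
  define \<kappa> where "\<kappa> = sqrt (2 * x * R)"
  define r where "r = sqrt R"
  have \<kappa>: "\<kappa> \<ge> 0" "\<kappa>\<^sup>2 = 2 * x * R" and r: "r \<ge> 0" "r\<^sup>2 = R"
    using x R by (auto simp: \<kappa>_def r_def)
  have v1': "\<bar>v (a + \<epsilon>)\<bar> \<le> \<kappa>"
    using v1 by (simp add: \<kappa>_def real_le_rsqrt)
  have u1: "\<bar>l * u (a + \<epsilon>)\<bar> \<le> r"
  proof -
    have "(l * u (a + \<epsilon>))\<^sup>2 \<le> e (a + \<epsilon>)" by (simp add: component_energy_def power_mult_distrib)
    also have "\<dots> \<le> R" using energy_decreasing[of a "a + \<epsilon>"] eps \<open>0 \<le> a\<close> by (simp add: R_def)
    finally show ?thesis by (simp add: r_def real_le_rsqrt)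
  qed
  \<comment> \<open>The two windows shorten the free rotation, which therefore misses the right
    angle by \<open>2 * x\<close>; a fraction of that order of the displacement survives.\<close>
  have ang: "l * (b - \<epsilon> - (a + \<epsilon>)) = pi / 2 - 2 * x"
    using len by (simp add: x_def algebra_simps)
  have cos: "\<bar>cos (pi / 2 - 2 * x)\<bar> \<le> 2 * x"
    using abs_sin_x_le_abs_x[of "2 * x"] x by (simp add: cos_diff)
  have "l * u (b - \<epsilon>) = l * u (a + \<epsilon>) * cos (l * (b - \<epsilon> - (a + \<epsilon>))) + v (a + \<epsilon>) * sin (l * (b - \<epsilon> - (a + \<epsilon>)))"
    using gap free eps \<open>0 \<le> a\<close> by (intro free_rotation) auto
  also have "\<bar>\<dots>\<bar> \<le> \<bar>l * u (a + \<epsilon>)\<bar> * \<bar>cos (pi / 2 - 2 * x)\<bar> + \<bar>v (a + \<epsilon>)\<bar> * \<bar>sin (pi / 2 - 2 * x)\<bar>"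
    unfolding ang abs_mult[symmetric] by (rule abs_triangle_ineq)
  also have "\<dots> \<le> r * (2 * x) + \<kappa> * 1"
    using u1 cos v1' r \<kappa> by (intro add_mono mult_mono abs_sin_le_one) auto
  finally have u2: "\<bar>l * u (b - \<epsilon>)\<bar> \<le> 2 * x * r + \<kappa>" by (simp add: mult.commute)
  have "\<bar>u b - u (b - \<epsilon>)\<bar> \<le> r * \<epsilon>"
    using position_displacement[of a "b - \<epsilon>" b] gap eps \<open>0 \<le> a\<close> by (simp add: r_def R_def)
  then have "l * \<bar>u b - u (b - \<epsilon>)\<bar> \<le> l * (r * \<epsilon>)" using freq_pos by simp
  then have "\<bar>l * u b - l * u (b - \<epsilon>)\<bar> \<le> x * r"
    using freq_pos by (simp add: x_def abs_mult right_diff_distrib[symmetric] mult.commute mult.left_commute)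
  then have "\<bar>l * u b\<bar> \<le> 3 * x * r + \<kappa>" using u2 by linarith
  then have "(l * u b)\<^sup>2 \<le> (3 * x * r + \<kappa>)\<^sup>2"
    using x r \<kappa> by (metis abs_ge_zero power2_abs power_mono)
  also have "\<dots> \<le> 2 * (3 * x * r)\<^sup>2 + 2 * \<kappa>\<^sup>2"
    using sum_squares_bound[of "3 * x * r" \<kappa>] by (simp add: power2_sum)
  also have "\<dots> = 18 * (x * x) * R + 4 * x * R"
    by (simp add: power_mult_distrib \<kappa> r power2_eq_square[of x])
  \<comment> \<open>Here \<open>x * x\<close> is replaced by \<open>x\<close>. The displacement thus
    accounts for 18 + 4 and the velocity for 2 of the final constant 24.\<close>
  also have "\<dots> \<le> 18 * (x * 1) * R + 4 * x * R"
    using x R by (intro add_mono mult_right_mono mult_left_mono) auto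
  finally have "(l * u b)\<^sup>2 \<le> 22 * x * R" by (simp add: mult.commute)
  then have "e b \<le> 22 * x * R + 2 * x * R"
    using v2 unfolding component_energy_def power_mult_distrib by linarith
  also have "\<dots> = 24 * (l * \<epsilon>) * e a" by (simp add: x_def R_def)
  finally show ?thesis .
qed

end

section \<open>Solutions as trajectories\<close>

lemma at_within_nonneg_neq_bot: "(t::real) \<ge> 0 \<Longrightarrow> at t within {0..} \<noteq> bot"
  using at_le[of "{t<..}" "{0..}" t] trivial_limit_at_right_real[of t]
  by (metis bot.extremum_uniqueI atLeast_iff greaterThan_iff less_eq_real_def order_less_le_trans subsetI)

lemma deriv0_works:
  assumes "f differentiable (at t within {0..})"
  shows "(f has_real_derivative deriv0 f t) (at t within {0..})"
  using assms
  by (simp add: deriv0_def has_real_derivative_iff_has_vector_derivative vector_derivative_works[symmetric])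

lemma deriv0_eqI:
  assumes "(f has_real_derivative D) (at t within {0..})" "t \<ge> 0"
  shows "deriv0 f t = D"
  unfolding deriv0_def using assms at_within_nonneg_neq_bot
  by (intro vector_derivative_within) (auto simp: has_real_derivative_iff_has_vector_derivative)

lemma at_within_nonneg: "(t::real) > 0 \<Longrightarrow> at t within {0..} = at t"
  by (rule at_within_interior) (simp add: interior_Ici)

lemma classical_solution_trajectory:
  assumes "classical_solution l \<delta> u"
  shows "damped_trajectory l \<delta> {} u (deriv0 u)"
proof -
  have d: "(u has_real_derivative deriv0 u t) (at t within {0..})"
    "(deriv0 u has_real_derivative - 2 * \<delta> t * deriv0 u t - l\<^sup>2 * u t) (at t within {0..})"
    if "t \<ge> 0" for t
  proof -
    have *: "u differentiable (at t within {0..})" "deriv0 u differentiable (at t within {0..})"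
      "deriv0 (deriv0 u) t = - 2 * \<delta> t * deriv0 u t - l\<^sup>2 * u t"
      using assms that by (auto simp: classical_solution_def differentiable_on_def damped_eq_def)
    show "(u has_real_derivative deriv0 u t) (at t within {0..})"
      "(deriv0 u has_real_derivative - 2 * \<delta> t * deriv0 u t - l\<^sup>2 * u t) (at t within {0..})"
      using deriv0_works[OF *(1)] deriv0_works[OF *(2)] *(3) by auto
  qed
  have "continuous_on {0..} u" "continuous_on {0..} (deriv0 u)"
    using assms by (auto simp: classical_solution_def differentiable_imp_continuous_on)
  then show ?thesis
    unfolding damped_trajectory_def using d[OF less_imp_le] at_within_nonneg by fastforce
qed

text \<open>A point with members of \<open>I\<close> on both sides is interior, so any other member
  is the maximum or the minimum of \<open>I\<close>. Unbounded intervals are covered as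
  well.\<close>

lemma interval_diff_interior_subset:
  fixes I :: "real set"
  assumes "is_interval I"
  shows "I - interior I \<subseteq> {Inf I, Sup I}"
proof
  fix x assume x: "x \<in> I - interior I"
  have "(\<forall>y\<in>I. y \<le> x) \<or> (\<forall>y\<in>I. x \<le> y)"
  proof (rule ccontr)
    assume "\<not> ?thesis"
    then obtain y z where yz: "y \<in> I" "z \<in> I" "y < x" "x < z" by force
    then have "{y<..<z} \<subseteq> I"
      using mem_is_interval_1_I[OF assms yz(1,2)] by (simp add: subset_iff)
    then have "{y<..<z} \<subseteq> interior I"
      by (intro interior_maximal) auto
    then show False using x yz by auto
  qed
  then show "x \<in> {Inf I, Sup I}"
    using x cSup_eq_maximum[of x I] cInf_eq_minimum[of x I] by blast
qed

lemma constant_on_imp_isCont: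
  fixes f :: "real \<Rightarrow> real"
  assumes "f constant_on I" "t \<in> interior I"
  shows "isCont f t"
proof -
  obtain y where "\<And>x. x \<in> I \<Longrightarrow> f x = y"
    using assms(1) by (auto simp: constant_on_def)
  then have "continuous_on (interior I) f"
    using interior_subset[of I] continuous_on_eq[OF continuous_on_const, of "interior I" y f] by auto
  then show ?thesis
    using assms(2) by (simp add: continuous_on_eq_continuous_at)
qed

text \<open>A discontinuity at a positive time cannot be interior to a constancy interval, so it is
  an end of one of the finitely many covering \<open>{0..T}\<close>.\<close>

lemma piecewise_constant0_finite_discontinuities:
  assumes "piecewise_constant0 \<delta>"
  shows "finite ({t. t > 0 \<and> \<not> isCont \<delta> t} \<inter> {0..T})"
proof -
  obtain \<I> where \<I>: "finite \<I>" "{0..T} \<subseteq> \<Union>\<I>"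
      and I: "\<And>I. I \<in> \<I> \<Longrightarrow> is_interval I \<and> \<delta> constant_on I"
    using assms unfolding piecewise_constant0_def by metis
  have "{t. t > 0 \<and> \<not> isCont \<delta> t} \<inter> {0..T} \<subseteq> (\<Union>I\<in>\<I>. {Inf I, Sup I})"
  proof
    fix t assume t: "t \<in> {t. t > 0 \<and> \<not> isCont \<delta> t} \<inter> {0..T}"
    then have "t \<in> \<Union>\<I>" using \<I>(2) by (intro subsetD[OF \<I>(2)]) auto
    then obtain J where J: "J \<in> \<I>" "t \<in> J" by blast
    then have "t \<notin> interior J" using t I constant_on_imp_isCont by blast
    then show "t \<in> (\<Union>I\<in>\<I>. {Inf I, Sup I})"
      using interval_diff_interior_subset[of J] I J by blast
  qed
  then show ?thesis by (rule finite_subset) (use \<I>(1) in auto)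
qed

text \<open>Absolute continuity turns the equation almost everywhere into an integral equation for
  \<open>u'\<close>. Where \<open>\<delta>\<close> is continuous so is the integrand, and
  differentiating the integral recovers the equation at every such time. The null set of exceptions
  is thereby replaced by the locally finite \<open>S\<close>.\<close>

lemma caratheodory_solution_trajectory:
  assumes sol: "caratheodory_solution l \<delta> u"
    and fin: "\<And>T. finite (S \<inter> {0..T})" and cont: "\<And>t. t > 0 \<Longrightarrow> t \<notin> S \<Longrightarrow> isCont \<delta> t"
  shows "damped_trajectory l \<delta> S u (deriv0 u)"
proof -
  define v where "v = deriv0 u"
  define f where "f t = - 2 * \<delta> t * v t - l\<^sup>2 * u t" for t
  have contv: "continuous_on {0..} v" and contu: "continuous_on {0..} u"
    using sol by (auto simp: caratheodory_solution_def v_def differentiable_imp_continuous_on)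
  have du: "(u has_real_derivative v t) (at t)" if "t > 0" for t
  proof -
    have "u differentiable (at t within {0..})"
      using sol that by (auto simp: caratheodory_solution_def differentiable_on_def)
    from deriv0_works[OF this] show ?thesis
      by (simp add: v_def at_within_nonneg[OF that])
  qed
  obtain N where N: "N \<in> null_sets lebesgue"
      and Nd: "\<And>t. t \<ge> 0 \<Longrightarrow> t \<notin> N \<Longrightarrow> v differentiable (at t within {0..}) \<and> damped_eq l \<delta> u t"
    using sol unfolding caratheodory_solution_def eventually_ae_filter v_def by auto
  have int: "(f has_integral v s - v 0) {0..s}" if "s > 0" for s
  proof (rule absolutely_cont_has_integral)
    show "absolutely_cont_on_interval 0 s v"
      using sol that by (auto simp: caratheodory_solution_def locally_absolutely_cont0_def v_def)
    show "negligible N" using N negligible_iff_null_sets by blast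
    fix x assume x: "x \<in> {0..s} - N"
    have "deriv0 v x = f x"
      using Nd[of x] x by (simp add: damped_eq_def f_def v_def)
    then show "(v has_real_derivative f x) (at x within {0..s})"
      using Nd[of x] x deriv0_works[of v x] has_field_derivative_subset[of v _ x "{0..}" "{0..s}"] by auto
  qed (use that in simp)
  have dv: "(v has_real_derivative f t) (at t)" if t: "t > 0" "t \<notin> S" for t
  proof -
    have "isCont v t" "isCont u t" "isCont \<delta> t"
      using contv contu cont t
      by (auto intro: continuous_on_interior simp: interior_Ici)
    then have "isCont f t" unfolding f_def by (intro continuous_intros)
    moreover have "f integrable_on {0..t + 1}"
      using int[of "t + 1"] t has_integral_integrable by auto
    ultimately have "((\<lambda>s. integral {0..s} f) has_vector_derivative f t) (at t within ({0..t + 1} - {}))"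
      using t by (intro integral_has_vector_derivative_continuous_at)
        (auto intro: continuous_at_imp_continuous_at_within)
    moreover have "at t within {0..t + 1} = at t"
      using t by (intro at_within_interior) simp
    ultimately have "((\<lambda>s. integral {0..s} f) has_real_derivative f t) (at t)"
      by (simp add: has_real_derivative_iff_has_vector_derivative)
    then have "((\<lambda>s. v 0 + integral {0..s} f) has_real_derivative f t) (at t)"
      by (auto intro!: derivative_eq_intros)
    then show ?thesis
    proof (rule has_field_derivative_transform_within_open[where S = "{0<..}"])
      show "v 0 + integral {0..s} f = v s" if "s \<in> {0<..}" for s
        using integral_unique[OF int[of s]] that by simp
    qed (use t in auto)
  qed
  show ?thesis
    using fin contu contv du dv unfolding damped_trajectory_def f_def v_def by auto
qed

section \<open>A smooth bump\<close>

text \<open>Two-sided derivatives on the whole line, merely asserted to exist at each order, let the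
  closure properties go by induction without formulas for higher derivatives.\<close>

primrec differentiable_times :: "nat \<Rightarrow> (real \<Rightarrow> real) \<Rightarrow> bool" where
  "differentiable_times 0 f \<longleftrightarrow> True"
| "differentiable_times (Suc m) f \<longleftrightarrow>
     (\<exists>f'. (\<forall>x. (f has_real_derivative f' x) (at x)) \<and> differentiable_times m f')"

lemma differentiable_times_Suc_imp: "differentiable_times (Suc m) f \<Longrightarrow> differentiable_times m f"
  by (induction m arbitrary: f) fastforce+

lemma differentiable_times_const: "differentiable_times m (\<lambda>_. c)"
proof (induction m arbitrary: c)
  case (Suc m)
  then show ?case using DERIV_const by fastforce
qed simp

lemma differentiable_times_add:
  "differentiable_times m f \<Longrightarrow> differentiable_times m g \<Longrightarrow> differentiable_times m (\<lambda>x. f x + g x)"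
proof (induction m arbitrary: f g)
  case (Suc m)
  from Suc.prems obtain f' g' where
    "\<And>x. (f has_real_derivative f' x) (at x)" "differentiable_times m f'"
    "\<And>x. (g has_real_derivative g' x) (at x)" "differentiable_times m g'" by auto
  then have "(\<forall>x. ((\<lambda>x. f x + g x) has_real_derivative f' x + g' x) (at x))"
      "differentiable_times m (\<lambda>x. f' x + g' x)"
    using Suc.IH DERIV_add by blast+
  then show ?case by (auto intro: exI[of _ "\<lambda>x. f' x + g' x"])
qed simp

lemma differentiable_times_mult:
  "differentiable_times m f \<Longrightarrow> differentiable_times m g \<Longrightarrow> differentiable_times m (\<lambda>x. f x * g x)"
proof (induction m arbitrary: f g)
  case (Suc m)
  from Suc.prems obtain f' g' where
    *: "\<And>x. (f has_real_derivative f' x) (at x)" "differentiable_times m f'"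
    "\<And>x. (g has_real_derivative g' x) (at x)" "differentiable_times m g'" by auto
  have "((\<lambda>x. f x * g x) has_real_derivative f' x * g x + f x * g' x) (at x)" for x
    by (rule derivative_eq_intros * refl)+ simp
  moreover have "differentiable_times m (\<lambda>x. f' x * g x + f x * g' x)"
    using Suc * differentiable_times_Suc_imp by (intro differentiable_times_add) blast+
  ultimately show ?case by (auto intro: exI[of _ "\<lambda>x. f' x * g x + f x * g' x"])
qed simp

lemma differentiable_times_sum:
  assumes "\<And>i. i \<in> A \<Longrightarrow> differentiable_times m (f i)"
  shows "differentiable_times m (\<lambda>x. \<Sum>i\<in>A. f i x)"
  using assms
  by (induction A rule: infinite_finite_induct) (auto intro: differentiable_times_add differentiable_times_const)

lemma differentiable_times_affine:
  "differentiable_times m f \<Longrightarrow> differentiable_times m (\<lambda>x. f (a * x + b))"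
proof (induction m arbitrary: f)
  case (Suc m)
  from Suc.prems obtain f' where
    *: "\<And>x. (f has_real_derivative f' x) (at x)" "differentiable_times m f'" by auto
  have "((\<lambda>x. f (a * x + b)) has_real_derivative f' (a * x + b) * a) (at x)" for x
    by (rule DERIV_chain2[OF *(1)]) (auto intro!: derivative_eq_intros)
  moreover have "differentiable_times m (\<lambda>x. f' (a * x + b) * a)"
    using Suc.IH[OF *(2)] by (intro differentiable_times_mult differentiable_times_const)
  ultimately show ?case by (auto intro: exI[of _ "\<lambda>x. f' (a * x + b) * a"])
qed simp

text \<open>Local derivatives glue because each of them agrees with \<open>deriv f\<close> on its
  neighbourhood. This is meant for sums that are only locally finite.\<close>

lemma differentiable_times_local:
  assumes "\<And>x. \<exists>U g. open U \<and> x \<in> U \<and> differentiable_times m g \<and> (\<forall>y\<in>U. g y = f y)"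
  shows "differentiable_times m f"
  using assms
proof (induction m arbitrary: f)
  case (Suc m)
  have loc: "\<exists>U g'. open U \<and> x \<in> U \<and> differentiable_times m g' \<and>
      (\<forall>y\<in>U. (f has_real_derivative g' y) (at y))" for x
  proof -
    obtain U g g' where U: "open U" "x \<in> U" "\<And>y. (g has_real_derivative g' y) (at y)"
        "differentiable_times m g'" "\<And>y. y \<in> U \<Longrightarrow> g y = f y"
      using Suc.prems[of x] by auto
    have "(f has_real_derivative g' y) (at y)" if "y \<in> U" for y
      by (rule has_field_derivative_transform_within_open[OF U(3) U(1) that U(5)])
    then show ?thesis using U by blast
  qed
  have "(f has_real_derivative deriv f x) (at x)" for x
    using loc[of x] DERIV_imp_deriv by metis
  moreover have "differentiable_times m (deriv f)"
  proof (rule Suc.IH)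
    fix x
    show "\<exists>U g. open U \<and> x \<in> U \<and> differentiable_times m g \<and> (\<forall>y\<in>U. g y = deriv f y)"
      using loc[of x] DERIV_imp_deriv by metis
  qed
  ultimately show ?case by auto
qed simp

lemma differentiable_times_imp_smooth0:
  assumes "\<And>m. differentiable_times m f"
  shows "smooth0 f"
proof -
  \<comment> \<open>The induction needs a second function \<open>g\<close> agreeing with
    \<open>f\<close> on nonnegative times only, since \<open>deriv0\<close> is controlled nowhere
    else.\<close>
  have "(deriv0 ^^ m) g differentiable_on {0..}"
    if "differentiable_times (Suc m) f" "\<And>t. t \<ge> 0 \<Longrightarrow> g t = f t" for m f g
    using that
  proof (induction m arbitrary: f g)
    case (0 f g)
    then obtain f' where "\<And>x. (f has_real_derivative f' x) (at x)" by auto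
    then have "f differentiable_on {0..}"
      by (meson differentiable_on_def has_field_derivative_at_within real_differentiable_def)
    then have "g differentiable_on {0..}"
      using 0(2) by (force simp: differentiable_on_def intro: differentiable_transform_within[OF _ zero_less_one])
    then show ?case by simp
  next
    case (Suc m f g)
    then obtain f' where f': "\<And>x. (f has_real_derivative f' x) (at x)" "differentiable_times (Suc m) f'"
      by auto
    have "deriv0 g t = f' t" if "t \<ge> 0" for t
    proof (rule deriv0_eqI[OF _ that])
      show "(g has_real_derivative f' t) (at t within {0..})"
        by (rule has_field_derivative_transform_within[OF has_field_derivative_at_within[OF f'(1)], of 1])
           (use Suc.prems that in auto)
    qed
    then show ?case
      using Suc.IH[OF f'(2), of "deriv0 g"] by (simp add: funpow_swap1)
  qed
  then show ?thesis using assms unfolding smooth0_def by blast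
qed

text \<open>The functions \<open>x\<^bsup>-k\<^esup> e\<^bsup>-1/x\<^esup>\<close>, extended by \<open>0\<close> to the left; their span is closed under
  differentiation.\<close>

definition flat :: "nat \<Rightarrow> real \<Rightarrow> real" where
  "flat k x = (if x \<le> 0 then 0 else inverse x ^ k * exp (- inverse x))"

lemma flat_tendsto_0: "(flat k \<longlongrightarrow> 0) (at 0)"
proof -
  have "((\<lambda>x. inverse x ^ k / exp (inverse x)) \<longlongrightarrow> 0) (at_right (0::real))"
    by (rule filterlim_compose[OF tendsto_power_div_exp_0 filterlim_inverse_at_top_right])
  then have "(flat k \<longlongrightarrow> 0) (at_right 0)"
    by (rule Lim_transform_eventually)
       (auto simp: flat_def exp_minus field_simps eventually_at_right_less intro!: eventually_at_rightI[of 0 1])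
  moreover have "(flat k \<longlongrightarrow> 0) (at_left 0)"
    by (rule Lim_transform_eventually[OF tendsto_const]) (auto simp: flat_def intro!: eventually_at_leftI[of "-1"])
  ultimately show ?thesis by (simp add: filterlim_at_split)
qed

lemma flat_has_derivative:
  "(flat k has_real_derivative (- real k) * flat (Suc k) x + flat (Suc (Suc k)) x) (at x)"
proof -
  consider "x < 0" | "x = 0" | "x > 0" by linarith
  then show ?thesis
  proof cases
    case 1
    have "((\<lambda>_. 0) has_real_derivative 0) (at x)" by simp
    then have "(flat k has_real_derivative 0) (at x)"
      by (rule has_field_derivative_transform_within_open[where S = "{..<0}"]) (use 1 in \<open>auto simp: flat_def\<close>)
    then show ?thesis using 1 by (simp add: flat_def)
  next
    case 2
    \<comment> \<open>Away from 0, the difference quotient of \<open>flat k\<close> at 0 is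
      \<open>flat (Suc k)\<close> itself.\<close>
    have "((\<lambda>h. (flat k (0 + h) - flat k 0) / h) \<longlongrightarrow> 0) (at 0)"
      by (rule Lim_transform_eventually[OF flat_tendsto_0[of "Suc k"]])
         (auto simp: flat_def field_simps eventually_at_filter)
    then show ?thesis using 2 by (simp add: DERIV_def flat_def)
  next
    case 3
    have "((\<lambda>x. inverse x ^ k * exp (- inverse x)) has_real_derivative
        (- real k) * flat (Suc k) x + flat (Suc (Suc k)) x) (at x)"
      using 3
      by (auto intro!: derivative_eq_intros simp: flat_def field_simps power2_eq_square)
         (cases k; simp add: field_simps)
    then show ?thesis
      by (rule has_field_derivative_transform_within_open[where S = "{0<..}"]) (use 3 in \<open>auto simp: flat_def\<close>)
  qed
qed

lemma differentiable_times_flat: "differentiable_times m (flat k)"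
proof (induction m arbitrary: k)
  case (Suc m)
  have "differentiable_times m (\<lambda>x. (- real k) * flat (Suc k) x + flat (Suc (Suc k)) x)"
    by (intro differentiable_times_add differentiable_times_mult differentiable_times_const Suc)
  moreover have "\<forall>x. (flat k has_real_derivative (- real k) * flat (Suc k) x + flat (Suc (Suc k)) x) (at x)"
    by (intro allI flat_has_derivative)
  ultimately show ?case
    by (simp only: differentiable_times.simps) (rule exI, rule conjI)
qed simp

text \<open>On the middle half of the unit interval both flat factors are at least
  \<open>exp (-4)\<close>; the factor \<open>exp 8\<close> normalises the plateau to height at least
  1.\<close>

definition bump :: "real \<Rightarrow> real" where
  "bump x = exp 8 * (flat 0 x * flat 0 (1 - x))"

lemma bump_nonneg: "bump x \<ge> 0"
  by (simp add: bump_def flat_def)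

lemma bump_outside: "x \<le> 0 \<or> x \<ge> 1 \<Longrightarrow> bump x = 0"
  by (auto simp: bump_def flat_def)

lemma bump_ge_1:
  assumes "x \<in> {1/4..3/4}"
  shows "bump x \<ge> 1"
proof -
  have "exp (-4) \<le> flat 0 y" if "y \<in> {1/4..3/4}" for y
    using that by (auto simp: flat_def field_simps)
  then have "exp (-4) * exp (-4) \<le> flat 0 x * flat 0 (1 - x)"
    using assms by (intro mult_mono) (auto simp: flat_def)
  then have "exp 8 * (exp (-4) * exp (-4)) \<le> bump x"
    by (simp add: bump_def)
  then show ?thesis by (simp flip: exp_add)
qed

lemma differentiable_times_bump: "differentiable_times m bump"
proof -
  have "differentiable_times m (\<lambda>x. flat 0 ((-1) * x + 1))"
    by (rule differentiable_times_affine[OF differentiable_times_flat])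
  then show ?thesis
    unfolding bump_def
    by (intro differentiable_times_mult differentiable_times_const differentiable_times_flat) simp
qed

section \<open>Trains of pulses\<close>

text \<open>The profile \<open>B\<close> stays abstract so that smooth and rectangular pulses share
  one argument. The nodes \<open>s i\<close> bound the cells, and \<open>gap\<close> leaves room for
  one window of width \<open>\<epsilon> i\<close> at each end of a cell.\<close>

locale pulse_train =
  fixes B :: "real \<Rightarrow> real" and s \<epsilon> M :: "nat \<Rightarrow> real"
  assumes B_nonneg: "\<And>x. B x \<ge> 0"
    and B_outside: "\<And>x. x \<le> 0 \<or> x \<ge> 1 \<Longrightarrow> B x = 0"
    and s_0: "s 0 = 0"
    and eps_pos: "\<And>i. \<epsilon> i > 0"
    and gap: "\<And>i. s i + 2 * \<epsilon> i \<le> s (Suc i)"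
    and M_pos: "\<And>i. M i > 0"
    and s_unbounded: "\<And>t. \<exists>N. t < s N"
begin

definition pulses :: "nat \<Rightarrow> real \<Rightarrow> real" where
  "pulses i t = M i * (B ((t - s i) / \<epsilon> i) + B ((s (Suc i) - t) / \<epsilon> i))"

text \<open>At any time at most one summand is nonzero, so the series is harmless.\<close>

definition train :: "real \<Rightarrow> real" where
  "train t = (\<Sum>i. pulses i t)"

lemma s_Suc_less: "s i < s (Suc i)"
  using gap[of i] eps_pos[of i] by simp

lemma s_mono: "i \<le> j \<Longrightarrow> s i \<le> s j"
  by (rule lift_Suc_mono_le[of s]) (use s_Suc_less less_imp_le in auto)

lemma s_nonneg: "s i \<ge> 0"
  using s_mono[of 0 i] s_0 by simp

lemma pulses_nonneg: "pulses i t \<ge> 0"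
  using M_pos[of i] B_nonneg by (simp add: pulses_def)

lemma B_left_outside: "t \<le> s i \<or> t \<ge> s i + \<epsilon> i \<Longrightarrow> B ((t - s i) / \<epsilon> i) = 0"
  using eps_pos[of i] by (intro B_outside) (auto simp: field_simps)

lemma B_right_outside: "t \<ge> s (Suc i) \<or> t \<le> s (Suc i) - \<epsilon> i \<Longrightarrow> B ((s (Suc i) - t) / \<epsilon> i) = 0"
  using eps_pos[of i] by (intro B_outside) (auto simp: field_simps)

lemma pulses_outside:
  assumes "t \<le> s i \<or> t \<ge> s (Suc i)"
  shows "pulses i t = 0"
  using assms gap[of i] eps_pos[of i] B_left_outside[where t = t and i = i] B_right_outside[where t = t and i = i]
  by (auto simp: pulses_def)

lemma train_eq_sum:
  assumes "t \<le> s N"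
  shows "train t = (\<Sum>i<N. pulses i t)"
  unfolding train_def
proof (rule suminf_finite)
  fix i assume "i \<notin> {..<N}"
  then show "pulses i t = 0"
    using assms s_mono[of N i] by (intro pulses_outside) auto
qed simp

lemma train_eq_pulses:
  assumes "s i \<le> t" "t \<le> s (Suc i)"
  shows "train t = pulses i t"
proof -
  have "train t = (\<Sum>j\<in>{i}. pulses j t)"
    unfolding train_def
  proof (rule suminf_finite)
    fix j assume "j \<notin> {i}"
    then consider "Suc j \<le> i" | "Suc i \<le> j" by force
    then show "pulses j t = 0"
      using assms s_mono[of "Suc j" i] s_mono[of "Suc i" j] by cases (auto intro!: pulses_outside)
  qed simp
  then show ?thesis by simp
qed

lemma train_nonneg: "train t \<ge> 0"
proof -
  obtain N where "t < s N" using s_unbounded by blast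
  then have "train t = (\<Sum>i<N. pulses i t)" by (intro train_eq_sum) simp
  then show ?thesis by (simp add: sum_nonneg pulses_nonneg)
qed

text \<open>To the left of any node \<open>s N\<close> the train is a finite sum of rescaled,
  shifted and reflected profiles.\<close>

lemma differentiable_times_train:
  assumes "differentiable_times m B"
  shows "differentiable_times m train"
proof (rule differentiable_times_local)
  fix t
  have affine: "differentiable_times m (\<lambda>t. B ((t - c) / d))" "differentiable_times m (\<lambda>t. B ((c - t) / d))" for c d
    using differentiable_times_affine[OF assms, of "1 / d" "- c / d"]
      differentiable_times_affine[OF assms, of "- 1 / d" "c / d"]
    by (simp_all add: diff_divide_distrib)
  obtain N where N: "t < s N" using s_unbounded by blast
  have "differentiable_times m (\<lambda>t. \<Sum>i<N. pulses i t)"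
    unfolding pulses_def
    by (intro differentiable_times_sum differentiable_times_mult differentiable_times_add
        differentiable_times_const affine)
  then show "\<exists>U g. open U \<and> t \<in> U \<and> differentiable_times m g \<and> (\<forall>y\<in>U. g y = train y)"
    using N train_eq_sum[of _ N] by (intro exI[of _ "{..<s N}"] exI[of _ "\<lambda>t. \<Sum>i<N. pulses i t"]) auto
qed

lemma cell_exists:
  assumes "0 \<le> t" "t < s N"
  shows "\<exists>i<N. s i \<le> t \<and> t < s (Suc i)"
  using assms
proof (induction N)
  case 0
  then show ?case using s_0 by simp
next
  case (Suc N)
  then show ?case by (cases "t < s N") (auto intro: less_SucI)
qed

text \<open>The profile is supported away from the ends of \<open>[0, 1]\<close>, as otherwise the nodes \<open>s i\<close> would be
  isolated exceptional values.\<close>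

lemma piecewise_constant0_train:
  assumes "B = indicator {1/4..3/4}"
  shows "piecewise_constant0 train"
  unfolding piecewise_constant0_def
proof
  fix T
  have B_eq: "B y = (if y \<in> {1/4..3/4} then 1 else 0)" for y
    by (simp add: assms indicator_def)
  obtain N where N: "T < s N" using s_unbounded by blast
  \<comment> \<open>Each cell splits into rest, plateau, rest, plateau, rest. By \<open>gap\<close>
    the middle rest has length at least \<open>\<epsilon> i / 2\<close>, so no piece
    degenerates.\<close>
  define F where "F i = {{s i..<s i + \<epsilon> i / 4}, {s i + \<epsilon> i / 4..s i + 3 * \<epsilon> i / 4},
    {s i + 3 * \<epsilon> i / 4<..<s (Suc i) - 3 * \<epsilon> i / 4},
    {s (Suc i) - 3 * \<epsilon> i / 4..s (Suc i) - \<epsilon> i / 4}, {s (Suc i) - \<epsilon> i / 4<..<s (Suc i)}}" for i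
  have "I \<subseteq> {0..} \<and> is_interval I \<and> interior I \<noteq> {} \<and> train constant_on I" if IF: "I \<in> F i" for i I
  proof -
    note i = gap[of i] eps_pos[of i]
    have sub: "I \<subseteq> {s i..s (Suc i)}"
      using that i by (auto simp: F_def)
    have "train t = (if (t - s i) / \<epsilon> i \<in> {1/4..3/4} \<or> (s (Suc i) - t) / \<epsilon> i \<in> {1/4..3/4} then M i else 0)"
      if "t \<in> I" for t
    proof -
      \<comment> \<open>The two plateaus are disjoint; an overlap would produce the value
        \<open>2 * M i\<close>.\<close>
      have "\<not> ((t - s i) / \<epsilon> i \<in> {1/4..3/4} \<and> (s (Suc i) - t) / \<epsilon> i \<in> {1/4..3/4})"
        using i by (auto simp: field_simps)
      moreover have "train t = pulses i t" using sub that by (intro train_eq_pulses) auto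
      ultimately show ?thesis
        by (auto simp: pulses_def B_eq)
    qed
    then have tr: "train t = (if t \<in> {s i + \<epsilon> i / 4..s i + 3 * \<epsilon> i / 4} \<or>
        t \<in> {s (Suc i) - 3 * \<epsilon> i / 4..s (Suc i) - \<epsilon> i / 4} then M i else 0)" if "t \<in> I" for t
      using that i by (simp add: field_simps)
    consider "I = {s i..<s i + \<epsilon> i / 4}" | "I = {s i + \<epsilon> i / 4..s i + 3 * \<epsilon> i / 4}"
      | "I = {s i + 3 * \<epsilon> i / 4<..<s (Suc i) - 3 * \<epsilon> i / 4}"
      | "I = {s (Suc i) - 3 * \<epsilon> i / 4..s (Suc i) - \<epsilon> i / 4}"
      | "I = {s (Suc i) - \<epsilon> i / 4<..<s (Suc i)}"
      using IF unfolding F_def by blast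
    then have "(\<forall>t\<in>I. train t = M i) \<or> (\<forall>t\<in>I. train t = 0)"
    proof cases
      case 1 then have "\<forall>t\<in>I. train t = 0" using tr i by auto
      then show ?thesis ..
    next
      case 2 then have "\<forall>t\<in>I. train t = M i" using tr i by auto
      then show ?thesis ..
    next
      case 3 then have "\<forall>t\<in>I. train t = 0" using tr i by auto
      then show ?thesis ..
    next
      case 4 then have "\<forall>t\<in>I. train t = M i" using tr i by auto
      then show ?thesis ..
    next
      case 5 then have "\<forall>t\<in>I. train t = 0" using tr i by auto
      then show ?thesis ..
    qed
    then have "train constant_on I" by (auto simp: constant_on_def)
    moreover have "is_interval I \<and> interior I \<noteq> {}"
      using IF i unfolding F_def
      by (auto simp: is_interval_cc is_interval_co is_interval_oo interior_atLeastLessThan)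
    moreover have "I \<subseteq> {0..}" using sub s_nonneg[of i] by force
    ultimately show ?thesis by blast
  qed
  moreover have "{0..T} \<subseteq> \<Union>(\<Union>i<N. F i)"
  proof
    fix t assume "t \<in> {0..T}"
    then obtain i where i: "i < N" "s i \<le> t" "t < s (Suc i)"
      using cell_exists[of t N] N by auto
    then have "t \<in> \<Union>(F i)"
      using gap[of i] eps_pos[of i] by (auto simp: F_def)
    then show "t \<in> \<Union>(\<Union>i<N. F i)" using i by blast
  qed
  moreover have "finite (\<Union>i<N. F i)" by (auto simp: F_def)
  ultimately show "\<exists>\<I>. finite \<I> \<and> {0..T} \<subseteq> \<Union>\<I> \<and>
      (\<forall>I\<in>\<I>. is_interval I \<and> interior I \<noteq> {} \<and> I \<subseteq> {0..} \<and> train constant_on I)"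
    by (intro exI[of _ "\<Union>i<N. F i"]) blast
qed

lemma train_contraction:
  assumes B1: "\<And>x. x \<in> {1/4..3/4} \<Longrightarrow> B x \<ge> 1" and l: "l > 0"
    and len: "s (Suc i) = s i + pi / (2 * l)" and x: "l * \<epsilon> i \<le> 1 / 2" and M: "M i = 1 / (2 * l * (\<epsilon> i)\<^sup>2)"
    and traj: "damped_trajectory l train S u v"
  shows "component_energy l u v (s (Suc i)) \<le> 24 * (l * \<epsilon> i) * component_energy l u v (s i)"
proof -
  note i = gap[of i] eps_pos[of i] M_pos[of i]
  interpret damped_oscillator l train S u v
    using traj train_nonneg l by unfold_locales
  have ge: "train t \<ge> M i" if "s i \<le> t" "t \<le> s (Suc i)"
    "(t - s i) / \<epsilon> i \<in> {1/4..3/4} \<or> (s (Suc i) - t) / \<epsilon> i \<in> {1/4..3/4}" for t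
  proof -
    have "1 \<le> B ((t - s i) / \<epsilon> i) + B ((s (Suc i) - t) / \<epsilon> i)"
      using that(3) B1 B_nonneg by (meson add_increasing add_increasing2)
    then have "M i * 1 \<le> pulses i t"
      unfolding pulses_def using i(3) by (intro mult_left_mono) auto
    then show ?thesis using that by (simp add: train_eq_pulses)
  qed
  show ?thesis
  proof (rule quarter_period_contraction[OF s_nonneg len eps_pos x M])
    show "M i \<le> train t" if "t \<in> {s i + \<epsilon> i / 4..s i + 3 * \<epsilon> i / 4}" for t
      using that i by (intro ge) (auto simp: field_simps)
    show "M i \<le> train t" if "t \<in> {s (Suc i) - 3 * \<epsilon> i / 4..s (Suc i) - \<epsilon> i / 4}" for t
      using that i by (intro ge) (auto simp: field_simps)
    show "train t = 0" if "t \<in> {s i + \<epsilon> i<..<s (Suc i) - \<epsilon> i}" for t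
      using that i B_left_outside[where t = t and i = i] B_right_outside[where t = t and i = i]
      by (subst train_eq_pulses[of i]) (auto simp: pulses_def)
  qed
qed

end

section \<open>Choice of the pulse parameters and decay of the total energy\<close>

lemma energy_eq_component_energy:
  "energy n lam u t = (\<Sum>k=1..n. component_energy (lam k) (u k) (deriv0 (u k)) t)"
  by (simp add: energy_def component_energy_def)

lemma sum_lessThan_add: "(\<Sum>i<a + m. f i) = (\<Sum>i<a. f i) + (\<Sum>i<m. f (a + i :: nat) :: real)"
  by (induction m) auto

lemma pulse_train_decay:
  fixes n :: nat and lam :: "nat \<Rightarrow> real" and \<phi> :: "real \<Rightarrow> real" and t0 :: real
  assumes n: "n \<ge> 1"
    and lam: "\<And>k. k \<in> {1..n} \<Longrightarrow> lam k > 0"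
    and \<phi>: "\<And>t. t \<ge> 0 \<Longrightarrow> \<phi> t > 0"
    and anti: "antimono_on {0..} \<phi>"
    and t0: "t0 = pi / 2 * (\<Sum>k=1..n. 1 / lam k)"
    and B_nonneg: "\<And>x. B x \<ge> 0" and B_outside: "\<And>x. x \<le> 0 \<or> x \<ge> 1 \<Longrightarrow> B x = 0"
    and B1: "\<And>x. x \<in> {1/4..3/4} \<Longrightarrow> B x \<ge> 1"
  obtains s \<epsilon> M where "pulse_train B s \<epsilon> M"
    and "\<And>u t. (\<And>k. k \<in> {1..n} \<Longrightarrow>
            \<exists>S. damped_trajectory (lam k) (pulse_train.train B s \<epsilon> M) S (u k) (deriv0 (u k))) \<Longrightarrow>
          t \<ge> t0 \<Longrightarrow> energy n lam u t \<le> energy n lam u 0 * \<phi> t"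
proof -
  \<comment> \<open>The oscillators are served cyclically, one cell each; \<open>Suc\<close> appears
    because their indices start at 1.\<close>
  define l where "l i = lam (Suc (i mod n))" for i
  define s where "s i = (\<Sum>j<i. pi / (2 * l j))" for i
  \<comment> \<open>Cell \<open>i\<close> belongs to round \<open>i div n\<close>, counted from 0.
    The contraction made there must suffice until the end of the following round, which is the time
    where \<open>\<phi>\<close> is evaluated.\<close>
  define c where "c i = \<phi> (real (i div n + 2) * t0)" for i
  \<comment> \<open>This will be \<open>l i * \<epsilon> i\<close>. The bound \<open>1 / 2\<close>
    is the one required for a contraction, and the division by 24 absorbs its constant.\<close>
  define x where "x i = min (1 / 2) (c i / 24)" for i
  define \<epsilon> where "\<epsilon> i = x i / l i" for i
  define M where "M i = 1 / (2 * l i * (\<epsilon> i)\<^sup>2)" for i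
  have l: "l i > 0" for i
    unfolding l_def using n by (intro lam) (simp add: Suc_leI)
  have period: "(\<Sum>i<n. pi / (2 * lam (Suc i))) = t0"
    unfolding t0 by (simp add: sum.atLeast1_atMost_eq sum_distrib_left)
  have t0_pos: "t0 > 0"
    unfolding t0 using n lam by (intro mult_pos_pos sum_pos) auto
  have s_period: "s (n * j) = real j * t0" for j
  proof (induction j)
    case (Suc j)
    have "s (n * Suc j) = s (n * j) + (\<Sum>i<n. pi / (2 * l (n * j + i)))"
      unfolding s_def using sum_lessThan_add[of _ "n * j" n] by (simp add: add.commute)
    also have "(\<Sum>i<n. pi / (2 * l (n * j + i))) = t0"
      unfolding period[symmetric] by (rule sum.cong) (auto simp: l_def)
    finally show ?case using Suc by (simp add: algebra_simps)
  qed (simp add: s_def)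
  have c_pos: "c i > 0" for i
    unfolding c_def using t0_pos by (intro \<phi>) simp
  have x: "x i > 0" "x i \<le> 1 / 2" "24 * x i \<le> c i" for i
    using c_pos[of i] by (auto simp: x_def)
  have lx: "l i * \<epsilon> i = x i" for i
    using l[of i] by (simp add: \<epsilon>_def)
  have eps: "\<epsilon> i > 0" for i
    using l[of i] x(1)[of i] by (simp add: \<epsilon>_def)
  have sS: "s (Suc i) = s i + pi / (2 * l i)" for i
    by (simp add: s_def)
  interpret pulse_train B s \<epsilon> M
  proof
    show "s 0 = 0" by (simp add: s_def)
    show "0 < \<epsilon> i" for i by (rule eps)
    show "0 < M i" for i using eps[of i] l[of i] by (simp add: M_def)
    show "s i + 2 * \<epsilon> i \<le> s (Suc i)" for i
      using l[of i] x(2)[of i] pi_gt3 by (simp add: sS \<epsilon>_def field_simps)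
    show "\<exists>N. t < s N" for t
      using reals_Archimedean3[OF t0_pos] s_period by metis
  qed (use B_nonneg B_outside in auto)
  show ?thesis
  proof (rule that[of s \<epsilon> M])
    show "pulse_train B s \<epsilon> M" by unfold_locales
    fix u t
    assume sol: "\<And>k. k \<in> {1..n} \<Longrightarrow> \<exists>S. damped_trajectory (lam k) train S (u k) (deriv0 (u k))"
      and t: "t \<ge> t0"
    \<comment> \<open>The number of rounds completed by time \<open>t\<close>, at least 1 because
      \<open>t \<ge> t0\<close>.\<close>
    define j where "j = nat \<lfloor>t / t0\<rfloor>"
    have tt: "t / t0 \<ge> 1" using t t0_pos by simp
    then have rj: "real j = of_int \<lfloor>t / t0\<rfloor>" by (simp add: j_def)
    have "real j \<le> t / t0" "t / t0 < real j + 1" unfolding rj by linarith+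
    then have j: "real j * t0 \<le> t" "t \<le> real (j + 1) * t0"
      using t0_pos by (auto simp: field_simps)
    have j1: "j \<ge> 1" using tt unfolding j_def by linarith
    have "component_energy (lam k) (u k) (deriv0 (u k)) t
        \<le> component_energy (lam k) (u k) (deriv0 (u k)) 0 * \<phi> t" if k: "k \<in> {1..n}" for k
    proof -
      obtain S where S: "damped_trajectory (lam k) train S (u k) (deriv0 (u k))"
        using sol k by blast
      interpret damped_oscillator "lam k" train S "u k" "deriv0 (u k)"
        using S train_nonneg lam[OF k] by unfold_locales
      \<comment> \<open>The cell of oscillator \<open>k\<close> in the last completed round, which
        has number \<open>j - 1\<close>.\<close>
      define i where "i = n * (j - 1) + (k - 1)"
      have k1: "k - 1 < n" using k by auto
      then have i: "i div n = j - 1" "i mod n = k - 1" by (simp_all add: i_def)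
      have li: "l i = lam k" using k by (simp add: l_def i)
      have "j - 1 + 2 = j + 1" using j1 by simp
      then have ci: "c i = \<phi> (real (j + 1) * t0)" by (simp only: c_def i)
      have "Suc i \<le> n * (j - 1) + n" using k1 by (simp add: i_def)
      also have "\<dots> = n * j" using j1 by (cases j) auto
      finally have "s (Suc i) \<le> t" using s_mono s_period[of j] j(1) by fastforce
      \<comment> \<open>Only this one cell is needed for a contraction; before and after it,
        monotonicity of the energy suffices.\<close>
      then have "e t \<le> e (s (Suc i))"
        by (intro energy_decreasing s_nonneg)
      also have "\<dots> \<le> 24 * (lam k * \<epsilon> i) * e (s i)"
        using sS[of i] lx[of i] x(2)[of i]
        by (intro train_contraction[OF B1 lam[OF k] _ _ _ S]) (auto simp: li M_def)
      also have "\<dots> \<le> c i * e 0"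
        using lx[of i] x[of i] s_nonneg[of i] c_pos[of i] component_energy_nonneg energy_decreasing[of 0 "s i"]
        by (intro mult_mono) (auto simp: li)
      also have "\<dots> \<le> \<phi> t * e 0"
      proof (intro mult_right_mono component_energy_nonneg)
        show "c i \<le> \<phi> t"
          unfolding ci using j(2) t t0_pos by (intro monotone_onD[OF anti]) auto
      qed
      finally show ?thesis by (simp add: mult.commute)
    qed
    then show "energy n lam u t \<le> energy n lam u 0 * \<phi> t"
      unfolding energy_eq_component_energy sum_distrib_right by (rule sum_mono)
  qed
qed

section \<open>Smooth and piecewise constant dampings with prescribed decay\<close>

theorem theorem2p4:
  fixes n :: nat and lam :: "nat \<Rightarrow> real" and \<phi> :: "real \<Rightarrow> real" and t0 :: real
  assumes "n \<ge> 1"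
    and "\<And>k. k \<in> {1..n} \<Longrightarrow> lam k > 0"
    and "\<And>t. t \<ge> 0 \<Longrightarrow> \<phi> t > 0"
    and "antimono_on {0..} \<phi>"
    and "t0 = pi / 2 * (\<Sum>k=1..n. 1 / lam k)"
  shows "(\<exists>\<delta> :: real \<Rightarrow> real. (\<forall>t\<ge>0. \<delta> t \<ge> 0) \<and>
            (\<forall>u. system_solution n lam \<delta> u \<longrightarrow>
               (\<forall>t\<ge>t0. energy n lam u t \<le> energy n lam u 0 * \<phi> t))) \<and>
         (\<exists>\<delta> :: real \<Rightarrow> real. (\<forall>t\<ge>0. \<delta> t \<ge> 0) \<and> smooth0 \<delta> \<and>
            (\<forall>u. system_solution n lam \<delta> u \<longrightarrow>
               (\<forall>t\<ge>t0. energy n lam u t \<le> energy n lam u 0 * \<phi> t))) \<and>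
         (\<exists>\<delta> :: real \<Rightarrow> real. (\<forall>t\<ge>0. \<delta> t \<ge> 0) \<and> piecewise_constant0 \<delta> \<and>
            (\<forall>u. system_solution n lam \<delta> u \<longrightarrow>
               (\<forall>t\<ge>t0. energy n lam u t \<le> energy n lam u 0 * \<phi> t)))"
proof -
  have smooth: "\<exists>\<delta>. (\<forall>t\<ge>0. \<delta> t \<ge> 0) \<and> smooth0 \<delta> \<and> (\<forall>u. system_solution n lam \<delta> u \<longrightarrow>
      (\<forall>t\<ge>t0. energy n lam u t \<le> energy n lam u 0 * \<phi> t))"
  proof -
    obtain s \<epsilon> M where *: "pulse_train bump s \<epsilon> M"
      "\<And>u t. (\<And>k. k \<in> {1..n} \<Longrightarrow>
          \<exists>S. damped_trajectory (lam k) (pulse_train.train bump s \<epsilon> M) S (u k) (deriv0 (u k))) \<Longrightarrow>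
        t \<ge> t0 \<Longrightarrow> energy n lam u t \<le> energy n lam u 0 * \<phi> t"
      using pulse_train_decay[where B = bump, OF assms bump_nonneg bump_outside bump_ge_1] by blast
    interpret pulse_train bump s \<epsilon> M by (rule *(1))
    have smooth: "smooth0 train"
      by (intro differentiable_times_imp_smooth0 differentiable_times_train differentiable_times_bump)
    then have "train differentiable_on {0..}"
      unfolding smooth0_def by (metis funpow_0)
    then have cont: "continuous_on {0..} train"
      by (rule differentiable_imp_continuous_on)
    have "energy n lam u t \<le> energy n lam u 0 * \<phi> t" if "system_solution n lam train u" "t \<ge> t0" for u t
    proof (rule *(2)[OF _ that(2)])
      fix k assume "k \<in> {1..n}"
      then have "classical_solution (lam k) train (u k)"
        using that(1) cont by (simp add: system_solution_def)
      then show "\<exists>S. damped_trajectory (lam k) train S (u k) (deriv0 (u k))"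
        using classical_solution_trajectory by blast
    qed
    then show ?thesis using train_nonneg smooth by blast
  qed
  moreover have "\<exists>\<delta>. (\<forall>t\<ge>0. \<delta> t \<ge> 0) \<and> piecewise_constant0 \<delta> \<and> (\<forall>u. system_solution n lam \<delta> u \<longrightarrow>
      (\<forall>t\<ge>t0. energy n lam u t \<le> energy n lam u 0 * \<phi> t))"
  proof -
    let ?B = "indicator {1/4..3/4} :: real \<Rightarrow> real"
    have B: "\<And>x. ?B x \<ge> 0" "\<And>x. x \<le> 0 \<or> x \<ge> 1 \<Longrightarrow> ?B x = 0" "\<And>x. x \<in> {1/4..3/4} \<Longrightarrow> ?B x \<ge> 1"
      by (auto simp: indicator_def)
    obtain s \<epsilon> M where *: "pulse_train ?B s \<epsilon> M"
      "\<And>u t. (\<And>k. k \<in> {1..n} \<Longrightarrow>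
          \<exists>S. damped_trajectory (lam k) (pulse_train.train ?B s \<epsilon> M) S (u k) (deriv0 (u k))) \<Longrightarrow>
        t \<ge> t0 \<Longrightarrow> energy n lam u t \<le> energy n lam u 0 * \<phi> t"
      using pulse_train_decay[where B = ?B, OF assms B] by blast
    interpret pulse_train ?B s \<epsilon> M by (rule *(1))
    have pc: "piecewise_constant0 train"
      by (rule piecewise_constant0_train) simp
    have "energy n lam u t \<le> energy n lam u 0 * \<phi> t" if "system_solution n lam train u" "t \<ge> t0" for u t
    proof (rule *(2)[OF _ that(2)])
      fix k assume "k \<in> {1..n}"
      \<comment> \<open>Both notions of solution yield a trajectory, so it need not be decided
        whether this train is continuous.\<close>
      then have "classical_solution (lam k) train (u k) \<or> caratheodory_solution (lam k) train (u k)"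
        using that(1) by (auto simp: system_solution_def split: if_splits)
      then show "\<exists>S. damped_trajectory (lam k) train S (u k) (deriv0 (u k))"
        using classical_solution_trajectory
          caratheodory_solution_trajectory[OF _ piecewise_constant0_finite_discontinuities[OF pc]] by blast
    qed
    then show ?thesis using train_nonneg pc by blast
  qed
  ultimately show ?thesis by blast
qed

end
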